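(* Let $k$ be a positive odd integer and $n$ a positive even integer. Among the $2^{k+n}$ assignments of over/under data to the crossings of the free $k\ n$ knot diagram, exactly $$2^k\binom{n}{\frac n2}+2\binom{k}{\frac{k-1}{2}}\binom{n}{\frac{n-2}{2}}$$ produce the unknot.
   Context: The free $k\ n$ knot diagram is the following planar closed curve with $k+n$ double points (the free closure of Conway's $k\ n$ tangle). Take a horizontal row of $n$ crossings: two parallel horizontal strands crossing each other $n$ times in succession, with four ends (upper-left, lower-left, upper-right, lower-right). Above it place a vertical column of $k$ crossings: two parallel vertical strands crossing each other $k$ times in succession, with four ends (upper-left, upper-right, lower-left, lower-right). Join the lower-left end of the column to the upper-left end of the row, the lower-right end of the column to the upper-right end of the row, the upper-left end of the column to the lower-left end of the row (by an arc around the left side), and the upper-right end of the column to the lower-right end of the row (by an arc around the right side), without creating further crossings. When at least one of $k$, $n$ is even this is a single closed curve. An assignment is a choice, at each crossing, of which of the two strands is the overstrand; it produces a knot diagram. *)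

theory Defs
  imports Main
begin

text \<open>
  Link diagrams in the plane, in general position with respect to the height function and read
  from top to bottom as a list of layers. Layer \<open>(i, p)\<close> consists of \<open>i\<close> vertical strands, then the
  elementary piece \<open>p\<close>, then vertical strands; so \<open>i\<close> is the position (counted from 0) of the leftmost
  strand that \<open>p\<close> touches or creates.

  \<open>Arch\<close> is a local maximum (two new strands start), \<open>Bowl\<close> a local minimum (two adjacent strands are
  joined). In \<open>Cross b\<close> two adjacent strands cross; the strand running from the upper left to the
  lower right is the overstrand iff \<open>b\<close>.
\<close>

datatype piece = Arch | Bowl | Cross bool

type_synonym layer = "nat \<times> piece"

fun ins :: "piece \<Rightarrow> nat" where
  "ins Arch = 0"
| "ins Bowl = 2"
| "ins (Cross b) = 2"

fun outs :: "piece \<Rightarrow> nat" where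
  "outs Arch = 2"
| "outs Bowl = 0"
| "outs (Cross b) = 2"

text \<open>\<open>tangle m D n\<close>: \<open>D\<close> is a tangle diagram with \<open>m\<close> ends at the top and \<open>n\<close> ends at the bottom.\<close>

fun tangle :: "nat \<Rightarrow> layer list \<Rightarrow> nat \<Rightarrow> bool" where
  "tangle m [] n \<longleftrightarrow> m = n"
| "tangle m ((i, p) # D) n \<longleftrightarrow> i + ins p \<le> m \<and> tangle (m - ins p + outs p) D n"

definition link_diagram :: "layer list \<Rightarrow> bool" where
  "link_diagram D \<longleftrightarrow> tangle 0 D 0"

text \<open>
  Planar isotopy of diagrams in this form is generated by \<open>exchange\<close> (disjoint pieces change their
  relative height), \<open>zigzag\<close> (a maximum and an adjacent minimum cancel) and \<open>slide\<close> (a strand is moved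
  across a local extremum of another one from one leg to the other; turning the crossing flips
  the Boolean, although the overstrand stays the same). The other rules are the three
  Reidemeister moves. In \<open>R3\<close>, with the strands numbered 1, 2, 3 at the top, \<open>a\<close>, \<open>b\<close>, \<open>c\<close> say that 1 is
  over 2, 1 is over 3 and 2 is over 3, respectively; the premise excludes exactly the two
  cyclic patterns, in which there is no top strand.
\<close>

inductive local_move :: "layer list \<Rightarrow> layer list \<Rightarrow> bool" where
  exchange: "i + outs p \<le> j \<Longrightarrow> local_move [(i, p), (j, q)] [(j - outs p + ins p, q), (i, p)]"
| zigzag_left: "local_move [(i, Arch), (Suc i, Bowl)] []"
| zigzag_right: "local_move [(Suc i, Arch), (i, Bowl)] []"
| slide_Arch:
    "local_move [(i, Arch), (Suc i, Cross b)] [(Suc i, Arch), (i, Cross (\<not> b))]"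
| slide_Bowl:
    "local_move [(i, Cross b), (Suc i, Bowl)] [(Suc i, Cross (\<not> b)), (i, Bowl)]"
| R1_right: "local_move [(Suc i, Arch), (i, Cross b), (Suc i, Bowl)] []"
| R1_left: "local_move [(i, Arch), (Suc i, Cross b), (i, Bowl)] []"
| R2: "local_move [(i, Cross b), (i, Cross (\<not> b))] []"
| R3: "a = b \<or> b = c \<Longrightarrow>
    local_move [(i, Cross a), (Suc i, Cross b), (i, Cross c)]
               [(Suc i, Cross c), (i, Cross b), (Suc i, Cross a)]"

inductive diagram_move :: "layer list \<Rightarrow> layer list \<Rightarrow> bool" where
  "local_move D E \<Longrightarrow> link_diagram (A @ D @ B) \<Longrightarrow> link_diagram (A @ E @ B) \<Longrightarrow>
    diagram_move (A @ D @ B) (A @ E @ B)"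

definition link_equivalent :: "layer list \<Rightarrow> layer list \<Rightarrow> bool" where
  "link_equivalent = equivclp diagram_move"

definition trivial_diagram :: "layer list" where
  "trivial_diagram = [(0, Arch), (0, Bowl)]"

definition produces_unknot :: "layer list \<Rightarrow> bool" where
  "produces_unknot D \<longleftrightarrow> link_diagram D \<and> link_equivalent D trivial_diagram"

text \<open>
  The free \<open>k n\<close> diagram with \<open>k = length col\<close> and \<open>n = length row\<close> (\<open>n > 0\<close>); \<open>col\<close> (from top to
  bottom) and \<open>row\<close> (from left to right) list the choices of overstrand.

  The first two layers are the tops of the outer arcs: strands 0 and 3 are the arcs around the
  left and right side, strands 1 and 2 the upper ends of the column. In the row, whose crossings
  lie side by side, consecutive crossings are joined by an arch between their upper ends and by a
  bowl between their lower ends. The first and last upper ends of the row are the lower ends of the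
  column. The last two layers join the outer arcs to the lower left and the lower right end of
  the row.
\<close>

definition free_diagram :: "bool list \<Rightarrow> bool list \<Rightarrow> layer list" where
  "free_diagram col row =
     [(0, Arch), (2, Arch)]
     @ map (\<lambda>b. (1, Cross b)) col
     @ replicate (length row - 1) (2, Arch)
     @ map (\<lambda>j. (2 * j + 1, Cross (row ! j))) [0..<length row]
     @ replicate (length row - 1) (2, Bowl)
     @ [(0, Bowl), (0, Bowl)]"

definition assignments :: "nat \<Rightarrow> nat \<Rightarrow> (bool list \<times> bool list) set" where
  "assignments k n = {(col, row). length col = k \<and> length row = n}"

end

theory Submission
  imports Defs Complex_Main
begin

text \<open>
  With \<open>a\<close> and \<open>m\<close> the signed numbers of crossings in the column and in the row, the closed diagram has
  determinant \<open>\<bar>1 + a m\<bar>\<close>. If this is not 1, then colouring the strands by powers of a nontrivial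
  root of unity whose order divides it, where the understrand colour \<open>y\<close> becomes \<open>x\<^sup>2 / y\<close> below
  an overstrand of colour \<open>x\<close>, gives a nonconstant colouring, which the unknot does not admit. As \<open>a\<close>
  is odd and \<open>m\<close> is even, the determinant is 1 iff \<open>m = 0\<close> or \<open>a m = - 2\<close>. In these cases, cancelling
  crossings of opposite sign leaves no crossing in the row, so that the column untwists, or one
  crossing in the column and two opposite ones in the row, which a third Reidemeister move and the
  removal of kinks undo.
\<close>

section \<open>Equivalence of tangle diagrams\<close>

definition shift :: "nat \<Rightarrow> layer list \<Rightarrow> layer list" where
  "shift k D = map (\<lambda>(i, p). (k + i, p)) D"

lemma shift_simps [simp]:
  "shift k [] = []" "shift k ((i, p) # D) = (k + i, p) # shift k D"
  "shift k (D @ E) = shift k D @ shift k E" "shift k (shift l D) = shift (k + l) D"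
  by (auto simp: shift_def)

lemma shift_0 [simp]: "shift 0 D = D"
  by (induction D) (auto simp: shift_def)

lemma tangle_append [simp]: "tangle l (D @ E) n \<longleftrightarrow> (\<exists>m. tangle l D m \<and> tangle m E n)"
  by (induction l D n rule: tangle.induct) auto

lemma tangle_unique: "tangle m D n \<Longrightarrow> tangle m D n' \<Longrightarrow> n = n'"
  by (induction m D n rule: tangle.induct) auto

lemma tangle_shift: "tangle m D n \<Longrightarrow> tangle (k + m + l) (shift k D) (k + n + l)"
proof (induction m D n rule: tangle.induct)
  case (2 m i p D n)
  then have "k + m + l - ins p + outs p = k + (m - ins p + outs p) + l" by auto
  with 2 show ?case by auto
qed auto

text \<open>\<open>diagram_move\<close> speaks of closed diagrams only. Fixing the numbers of ends
  instead allows moves to be carried out in a subtangle and then inserted into a larger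
  diagram.\<close>

inductive tangle_move :: "nat \<Rightarrow> nat \<Rightarrow> layer list \<Rightarrow> layer list \<Rightarrow> bool" for m n where
  "local_move D E \<Longrightarrow> tangle m (A @ D @ B) n \<Longrightarrow> tangle m (A @ E @ B) n \<Longrightarrow>
    tangle_move m n (A @ D @ B) (A @ E @ B)"

lemma tangle_moveD: "tangle_move m n D E \<Longrightarrow> tangle m D n \<and> tangle m E n"
  by (erule tangle_move.cases) simp

text \<open>\<open>equivclp\<close> relates every list of layers to itself, even one that is no
  diagram, so well-formedness of \<open>D\<close> is demanded separately. That of \<open>E\<close>
  then follows, because both sides of a move are tangles.\<close>

definition teq :: "nat \<Rightarrow> nat \<Rightarrow> layer list \<Rightarrow> layer list \<Rightarrow> bool" where
  "teq m n D E \<longleftrightarrow> tangle m D n \<and> equivclp (tangle_move m n) D E"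

lemma link_equivalent_iff_teq:
  "link_diagram D \<Longrightarrow> link_equivalent D E \<longleftrightarrow> teq 0 0 D E"
proof -
  have "diagram_move = tangle_move 0 0"
    by (auto simp: fun_eq_iff diagram_move.simps tangle_move.simps link_diagram_def)
  then show "link_diagram D \<Longrightarrow> ?thesis"
    by (simp add: link_equivalent_def teq_def link_diagram_def)
qed

lemma teq_refl: "tangle m D n \<Longrightarrow> teq m n D D"
  by (simp add: teq_def)

lemma equivclp_mono_map:
  assumes "equivclp R x y" "\<And>x y. R x y \<Longrightarrow> S (f x) (f y)"
  shows "equivclp S (f x) (f y)"
  using assms(1)
proof (induction rule: equivclp_induct)
  case (step y z)
  then have "S (f y) (f z) \<or> S (f z) (f y)" using assms(2) by auto
  then show ?case using step by (meson equivclp_into_equivclp)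
qed simp

lemma teq_tangle: "teq m n D E \<Longrightarrow> tangle m E n"
proof -
  have "equivclp (tangle_move m n) D E \<Longrightarrow> tangle m D n \<Longrightarrow> tangle m E n"
    by (induction rule: equivclp_induct) (auto dest: tangle_moveD)
  then show "teq m n D E \<Longrightarrow> ?thesis" by (simp add: teq_def)
qed

lemma teq_sym: "teq m n D E \<Longrightarrow> teq m n E D"
  using teq_tangle by (auto simp: teq_def intro: equivclp_sym)

lemma teq_trans [trans]: "teq m n D E \<Longrightarrow> teq m n E F \<Longrightarrow> teq m n D F"
  unfolding teq_def using equivclp_trans by metis

lemma teq_local:
  assumes "local_move D E" "tangle m D n" "tangle m E n"
  shows "teq m n D E"
  using tangle_move.intros[of D E m "[]" "[]" n] assms by (auto simp: teq_def)

lemma local_move_shift: "local_move D E \<Longrightarrow> local_move (shift k D) (shift k E)"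
proof (induction rule: local_move.induct)
  case (exchange i p j q)
  have "k + (j - outs p + ins p) = (k + j) - outs p + ins p" using exchange by simp
  then show ?case using local_move.exchange[of "k + i" p "k + j" q] exchange by simp
qed (auto intro: local_move.intros)

text \<open>Local moves are invariant under horizontal translation, so each single move on the inner
  tangle is also a move of the whole diagram, with \<open>k\<close> strands on its left and
  \<open>l\<close> on its right. \<open>equivclp_mono_map\<close> extends this to chains of
  moves.\<close>

lemma teq_in_context:
  assumes DE: "teq m n D E" and A: "tangle a A (k + m + l)" and B: "tangle (k + n + l) B c"
  shows "teq a c (A @ shift k D @ B) (A @ shift k E @ B)"
proof -
  have *: "tangle_move a c (A @ shift k X @ B) (A @ shift k Y @ B)"
    if XY: "tangle_move m n X Y" for X Y
    using XY
  proof cases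
    case (1 D E A' B')
    have "tangle a (A @ shift k X @ B) c" "tangle a (A @ shift k Y @ B) c"
      using 1 A B by (metis tangle_append tangle_shift)+
    then show ?thesis
      using tangle_move.intros[OF local_move_shift[OF 1(3), of k], of a "A @ shift k A'" "shift k B' @ B" c]
        1(1,2) by simp
  qed
  have "tangle a (A @ shift k D @ B) c"
    using DE A B by (metis tangle_append tangle_shift teq_def)
  moreover have "equivclp (tangle_move a c) (A @ shift k D @ B) (A @ shift k E @ B)"
    using DE equivclp_mono_map[of "tangle_move m n" D E "tangle_move a c" "\<lambda>X. A @ shift k X @ B"] *
    by (simp add: teq_def)
  ultimately show ?thesis by (simp add: teq_def)
qed

lemma teq_append:
  assumes "teq l m D D'" "teq m n E E'"
  shows "teq l n (D @ E) (D' @ E')"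
proof -
  have "teq l n ([] @ shift 0 D @ E) ([] @ shift 0 D' @ E)"
    by (rule teq_in_context[where l = 0, OF assms(1)]) (use assms in \<open>auto simp: teq_def\<close>)
  moreover have "teq l n (D' @ shift 0 E @ []) (D' @ shift 0 E' @ [])"
    by (rule teq_in_context[where l = 0, OF assms(2)]) (use assms in \<open>auto dest: teq_tangle\<close>)
  ultimately show ?thesis by simp (rule teq_trans)
qed

lemma teq_step:
  assumes "local_move D E \<or> local_move E D" "X = A @ D @ B" "Y = A @ E @ B" "tangle m X n" "tangle m Y n"
  shows "teq m n X Y"
proof -
  have "tangle_move m n X Y \<or> tangle_move m n Y X"
    using assms tangle_move.intros by metis
  then show ?thesis using assms unfolding teq_def by (auto intro: equivclp_sym)
qed

text \<open>The piece \<open>p\<close> passes the layers of \<open>E\<close>, which lies on its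
  right, one \<open>exchange\<close> at a time. A layer of \<open>E\<close> below \<open>p\<close>
  is offset by \<open>outs p\<close>, one above \<open>p\<close> by \<open>ins p\<close>.\<close>

lemma layer_commute:
  assumes "tangle m E n"
  shows "teq (i + ins p + m) (i + outs p + n)
    ((i, p) # shift (i + outs p) E) (shift (i + ins p) E @ [(i, p)])"
  using assms
proof (induction m E n rule: tangle.induct)
  case (1 m n)
  then show ?case by (auto intro: teq_refl)
next
  case (2 m j q E n)
  let ?m = "m - ins q + outs q"
  have jm: "j + ins q \<le> m" and E: "tangle ?m E n" using 2 by auto
  have w: "i + outs p + m - ins q + outs q = i + outs p + ?m"
    "i + ins p + m - ins q + outs q = i + ins p + ?m" "i + ins p + m - ins p + outs p = i + outs p + m"
    "i + ins p + ?m - ins p + outs p = i + outs p + ?m"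
    using jm by auto
  have sE: "tangle (c + ?m) (shift c E) (c + n)" for c
    using tangle_shift[OF E, of c 0] by simp
  have "teq (i + ins p + m) (i + outs p + n)
    ([(i, p), (i + outs p + j, q)] @ shift (i + outs p) E)
    ([(i + ins p + j, q), (i, p)] @ shift (i + outs p) E)"
  proof (rule teq_append[OF teq_local])
    have "i + outs p + j - outs p + ins p = i + ins p + j" by simp
    then show "local_move [(i, p), (i + outs p + j, q)] [(i + ins p + j, q), (i, p)]"
      using local_move.exchange[of i p "i + outs p + j" q] by (metis le_add1)
    show "teq (i + outs p + ?m) (i + outs p + n) (shift (i + outs p) E) (shift (i + outs p) E)"
      by (rule teq_refl[OF sE])
  qed (use jm w in auto)
  moreover have "teq (i + ins p + m) (i + outs p + n)
    ([(i + ins p + j, q)] @ ((i, p) # shift (i + outs p) E))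
    ([(i + ins p + j, q)] @ (shift (i + ins p) E @ [(i, p)]))"
    by (rule teq_append[OF teq_refl "2.IH"[OF E]]) (use jm w in auto)
  ultimately show ?case by simp (rule teq_trans)
qed

text \<open>Equational premises let the rules match numerals.\<close>

lemma local_moves:
  "i + outs p \<le> j \<Longrightarrow> j' = j - outs p + ins p \<Longrightarrow> local_move [(i, p), (j, q)] [(j', q), (i, p)]"
  "j = Suc i \<Longrightarrow> local_move [(i, Arch), (j, Bowl)] []"
  "j = Suc i \<Longrightarrow> local_move [(j, Arch), (i, Bowl)] []"
  "j = Suc i \<Longrightarrow> b' = (\<not> b) \<Longrightarrow> local_move [(i, Arch), (j, Cross b)] [(j, Arch), (i, Cross b')]"
  "j = Suc i \<Longrightarrow> b' = (\<not> b) \<Longrightarrow> local_move [(i, Cross b), (j, Bowl)] [(j, Cross b'), (i, Bowl)]"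
  "j = Suc i \<Longrightarrow> local_move [(j, Arch), (i, Cross b), (j, Bowl)] []"
  "j = Suc i \<Longrightarrow> local_move [(i, Arch), (j, Cross b), (i, Bowl)] []"
  "b' = (\<not> b) \<Longrightarrow> local_move [(i, Cross b), (i, Cross b')] []"
  "j = Suc i \<Longrightarrow> a = b \<or> b = c \<Longrightarrow>
    local_move [(i, Cross a), (j, Cross b), (i, Cross c)] [(j, Cross c), (i, Cross b), (j, Cross a)]"
  by (hypsubst, (rule local_move.intros; assumption))+

text \<open>The R1 rules remove a kink from a vertical strand. A zigzag inserted into the right
  strand brings the crossing above the minimum into this form, after two exchanges and a
  slide.\<close>

lemma cross_bowl: "teq 2 0 [(0, Cross b), (0, Bowl)] [(0, Bowl)]"
proof -
  have "teq 2 0 [(0, Cross b), (0, Bowl)] [(1, Arch), (2, Bowl), (0, Cross b), (0, Bowl)]"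
    by (rule teq_step[of "[]" "[(1, Arch), (2, Bowl)]" _ "[]" "[(0, Cross b), (0, Bowl)]"])
      (auto intro: local_moves)
  also have "teq 2 0 \<dots> [(1, Arch), (0, Cross b), (2, Bowl), (0, Bowl)]"
    by (rule teq_step[of "[(2, Bowl), (0, Cross b)]" "[(0, Cross b), (2, Bowl)]" _ "[(1, Arch)]" "[(0, Bowl)]"])
      (auto intro: local_moves)
  also have "teq 2 0 \<dots> [(1, Arch), (0, Cross b), (0, Bowl), (0, Bowl)]"
    by (rule teq_step[of "[(2, Bowl), (0, Bowl)]" "[(0, Bowl), (0, Bowl)]" _ "[(1, Arch), (0, Cross b)]" "[]"])
      (auto intro: local_moves)
  also have "teq 2 0 \<dots> [(0, Arch), (1, Cross (\<not> b)), (0, Bowl), (0, Bowl)]"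
    by (rule teq_step[of "[(1, Arch), (0, Cross b)]" "[(0, Arch), (1, Cross (\<not> b))]" _ "[]" "[(0, Bowl), (0, Bowl)]"])
      (auto intro: local_moves)
  also have "teq 2 0 \<dots> [(0, Bowl)]"
    by (rule teq_step[of "[(0, Arch), (1, Cross (\<not> b)), (0, Bowl)]" "[]" _ "[]" "[(0, Bowl)]"])
      (auto intro: local_moves)
  finally show ?thesis .
qed

section \<open>Columns and rows as tangles with two ends at the top and two at the bottom\<close>

definition column :: "bool list \<Rightarrow> layer list" where
  "column col = map (\<lambda>b. (0, Cross b)) col"

text \<open>Conway's horizontal sum of one crossing and \<open>X\<close>: the arch joins their
  neighbouring upper ends, the bowl their neighbouring lower ends. The nested form makes rows
  accessible to induction. The tangle that ends \<open>hrow\<close> consists of two horizontal arcs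
  and is neutral for this sum.\<close>

definition hcons :: "bool \<Rightarrow> layer list \<Rightarrow> layer list" where
  "hcons b X = [(1, Arch), (0, Cross b)] @ shift 2 X @ [(1, Bowl)]"

definition hrow :: "bool list \<Rightarrow> layer list" where
  "hrow row = foldr hcons row [(0, Bowl), (0, Arch)]"

lemma hrow_simps [simp]: "hrow [] = [(0, Bowl), (0, Arch)]" "hrow (b # row) = hcons b (hrow row)"
  by (auto simp: hrow_def)

lemma tangle_hcons: "tangle 2 X 2 \<Longrightarrow> tangle 2 (hcons b X) 2"
  using tangle_shift[of 2 X 2 2 0] by (auto simp: hcons_def intro!: exI[of _ 4])

lemma tangle_hrow: "tangle 2 (hrow row) 2"
  by (induction row) (auto intro: tangle_hcons)

lemma hcons_cong:
  assumes "teq 2 2 X Y"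
  shows "teq 2 2 (hcons b X) (hcons b Y)"
  unfolding hcons_def by (rule teq_in_context[OF assms, where l = 0]) auto

text \<open>This is the second Reidemeister move turned by a quarter. Sliding both crossings across
  the arches beside them and straightening zigzags brings one crossing below the other, where
  \<open>R2\<close> applies.\<close>

lemma hcons_cancel:
  assumes X: "tangle 2 X 2"
  shows "teq 2 2 (hcons b (hcons (\<not> b) X)) X"
proof -
  have sX: "n = k + 2 + l \<Longrightarrow> tangle n (shift k X) n" for n k l
    using tangle_shift[OF X] by simp
  have sX': "tangle 6 (shift 4 X) 6" "tangle 4 (shift 2 X) 4"
    by (rule sX[of _ _ 0], simp)+
  have "teq 2 2 (hcons b (hcons (\<not> b) X))
    ([(1, Arch), (0, Cross b), (3, Arch), (2, Cross (\<not> b))] @ shift 4 X @ [(3, Bowl), (1, Bowl)])"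
    by (auto simp: hcons_def intro!: teq_refl exI[of _ 6] sX')
  also have "teq 2 2 \<dots>
    ([(0, Arch), (1, Cross (\<not> b)), (3, Arch), (2, Cross (\<not> b))] @ shift 4 X @ [(3, Bowl), (1, Bowl)])"
    by (rule teq_step[of "[(1, Arch), (0, Cross b)]" "[(0, Arch), (1, Cross (\<not> b))]" _ "[]"
          "[(3, Arch), (2, Cross (\<not> b))] @ shift 4 X @ [(3, Bowl), (1, Bowl)]"])
      (auto intro: local_moves intro!: exI[of _ 6] sX')
  also have "teq 2 2 \<dots>
    ([(0, Arch), (1, Cross (\<not> b)), (2, Arch), (3, Cross b)] @ shift 4 X @ [(3, Bowl), (1, Bowl)])"
    by (rule teq_step[of "[(3, Arch), (2, Cross (\<not> b))]" "[(2, Arch), (3, Cross b)]" _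
          "[(0, Arch), (1, Cross (\<not> b))]" "shift 4 X @ [(3, Bowl), (1, Bowl)]"])
      (auto intro: local_moves intro!: exI[of _ 6] sX')
  also have "teq 2 2 \<dots>
    ([(0, Arch), (1, Cross (\<not> b)), (2, Arch), (3, Cross b)] @ shift 4 X @ [(1, Bowl), (1, Bowl)])"
    by (rule teq_step[of "[(3, Bowl), (1, Bowl)]" "[(1, Bowl), (1, Bowl)]" _
          "[(0, Arch), (1, Cross (\<not> b)), (2, Arch), (3, Cross b)] @ shift 4 X" "[]"])
      (auto intro: local_moves intro!: exI[of _ 6] sX')
  also have "teq 2 2 \<dots>
    ([(0, Arch), (1, Cross (\<not> b)), (2, Arch), (1, Bowl), (1, Cross b)] @ shift 2 X @ [(1, Bowl)])"
  proof -
    \<comment> \<open>The minimum between the two crossings lies to the left of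
      \<open>Cross b\<close> and of \<open>X\<close>, so it rises past both. Directly below the arch
      at position 2 it becomes half of a zigzag.\<close>
    have "teq 6 4 ((3, Cross b) # shift 4 X @ [(1, Bowl)]) ((1, Bowl) # (1, Cross b) # shift 2 X)"
      using teq_sym[OF layer_commute[of 3 "(0, Cross b) # shift 1 X" 3 1 Bowl]] sX[of 3 1 0]
      by (simp add: eval_nat_numeral)
    from teq_in_context[OF this, of 2 "[(0, Arch), (1, Cross (\<not> b)), (2, Arch)]" 0 0 "[(1, Bowl)]" 2]
    show ?thesis by (simp add: numeral_2_eq_2)
  qed
  also have "teq 2 2 \<dots> ([(0, Arch), (1, Cross (\<not> b)), (1, Cross b)] @ shift 2 X @ [(1, Bowl)])"
    by (rule teq_step[of "[(2, Arch), (1, Bowl)]" "[]" _ "[(0, Arch), (1, Cross (\<not> b))]"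
          "[(1, Cross b)] @ shift 2 X @ [(1, Bowl)]"])
      (auto intro: local_moves intro!: exI[of _ 4] sX')
  also have "teq 2 2 \<dots> ([(0, Arch)] @ shift 2 X @ [(1, Bowl)])"
    by (rule teq_step[of "[(1, Cross (\<not> b)), (1, Cross b)]" "[]" _ "[(0, Arch)]" "shift 2 X @ [(1, Bowl)]"])
      (auto intro: local_moves intro!: exI[of _ 4] sX')
  also have "teq 2 2 \<dots> (X @ [(0, Arch), (1, Bowl)])"
    \<comment> \<open>The remaining arch sinks below \<open>X\<close> and meets the last bowl,
      forming another zigzag.\<close>
    using teq_in_context[OF layer_commute[OF X, of 0 Arch], of 2 "[]" 0 0 "[(1, Bowl)]" 2]
    by (simp add: numeral_2_eq_2)
  also have "teq 2 2 \<dots> X"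
    by (rule teq_step[of "[(0, Arch), (1, Bowl)]" "[]" _ X "[]"])
      (auto intro: local_moves intro!: exI[of _ 2] X)
  finally show ?thesis .
qed

text \<open>The neutral tangle at the right end is absorbed by two zigzags.\<close>

lemma hrow_single: "teq 2 2 (hrow [b]) [(0, Cross b)]"
proof -
  have "teq 2 2 (hrow [b]) [(1, Arch), (0, Cross b), (2, Bowl), (2, Arch), (1, Bowl)]"
    by (auto simp: hcons_def intro: teq_refl)
  also have "teq 2 2 \<dots> [(1, Arch), (0, Cross b), (2, Bowl)]"
    by (rule teq_step[of "[(2, Arch), (1, Bowl)]" "[]" _ "[(1, Arch), (0, Cross b), (2, Bowl)]" "[]"])
      (auto intro: local_moves)
  also have "teq 2 2 \<dots> [(1, Arch), (2, Bowl), (0, Cross b)]"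
    by (rule teq_step[of "[(0, Cross b), (2, Bowl)]" "[(2, Bowl), (0, Cross b)]" _ "[(1, Arch)]" "[]"])
      (auto intro: local_moves)
  also have "teq 2 2 \<dots> [(0, Cross b)]"
    by (rule teq_step[of "[(1, Arch), (2, Bowl)]" "[]" _ "[]" "[(0, Cross b)]"])
      (auto intro: local_moves)
  finally show ?thesis .
qed

section \<open>Comparison of the row in \<open>free_diagram\<close> with the nested row\<close>

lemma shift_replicate [simp]: "shift k (replicate m (i, p)) = replicate m (k + i, p)"
  by (induction m) auto

lemma tangle_arches: "tangle (i + l) (replicate m (i, Arch)) (i + l + 2 * m)"
proof (induction m arbitrary: l)
  case (Suc m)
  show ?case using Suc[of "l + 2"] by (simp add: algebra_simps)
qed simp

lemma tangle_bowls: "tangle (i + l + 2 * m) (replicate m (i, Bowl)) (i + l)"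
  by (induction m) (auto simp: algebra_simps)

lemma tangle_crosses: "(\<And>i p. (i, p) \<in> set D \<Longrightarrow> i + 2 \<le> m \<and> (\<exists>b. p = Cross b)) \<Longrightarrow> tangle m D m"
proof (induction D)
  case (Cons x D)
  obtain i p where "x = (i, p)" by (cases x)
  with Cons.prems[of i p] obtain b where "x = (i, Cross b)" "i + 2 \<le> m" by auto
  moreover have "tangle m D m" using Cons by (meson list.set_intros(2))
  moreover from \<open>i + 2 \<le> m\<close> obtain l where "m = Suc (Suc l)"
    using not0_implies_Suc[of m] not0_implies_Suc[of "m - 1"] by fastforce
  ultimately show ?case by simp
qed simp

definition row_crossings :: "bool list \<Rightarrow> layer list" where
  "row_crossings row = map (\<lambda>j. (2 * j, Cross (row ! j))) [0..<length row]"

text \<open>The row as it is drawn in \<open>free_diagram\<close>, without the outer arc on the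
  left; hence all positions are smaller by one.\<close>

definition flat_row :: "bool list \<Rightarrow> layer list" where
  "flat_row row = replicate (length row - 1) (1, Arch) @ row_crossings row
    @ replicate (length row - 1) (1, Bowl)"

lemma row_crossings_Cons: "row_crossings (b # row) = (0, Cross b) # shift 2 (row_crossings row)"
  by (simp add: row_crossings_def shift_def upt_conv_Cons o_def del: upt_Suc flip: map_Suc_upt)

lemma tangle_row_crossings: "tangle (2 * length row) (row_crossings row) (2 * length row)"
  by (rule tangle_crosses) (auto simp: row_crossings_def)

text \<open>The two diagrams differ only in the heights of their pieces, so exchanges
  suffice.\<close>

lemma flat_row_Cons:
  assumes "row \<noteq> []"
  shows "teq 2 2 (flat_row (b # row)) (hcons b (flat_row row))"
proof -
  obtain m where m: "length row = Suc m" using assms by (cases row) auto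
  define C where "C = shift 2 (row_crossings row)"
  have C: "tangle (4 + 2 * m) C (4 + 2 * m)"
    using tangle_shift[OF tangle_row_crossings[of row], of 2 0] m by (simp add: C_def numeral_eq_Suc)
  have A: "tangle (l + 1) (replicate m (1, Arch)) (l + 1 + 2 * m)"
    "tangle (l + 1 + 2 * m) (replicate m (1, Bowl)) (l + 1)"
    "tangle (l + 3) (replicate m (3, Arch)) (l + 3 + 2 * m)"
    "tangle (l + 3 + 2 * m) (replicate m (3, Bowl)) (l + 3)"
    "tangle l (replicate m (0, Arch)) (l + 2 * m)"
    "tangle (l + 2 * m) (replicate m (0, Bowl)) l" for l
    using tangle_arches[of 1 l m] tangle_bowls[of 1 l m] tangle_arches[of 3 l m] tangle_bowls[of 3 l m]
       tangle_arches[of 0 l m] tangle_bowls[of 0 l m]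
    by (simp_all add: add_ac)
  \<comment> \<open>Each arch at position 1 is inserted to the left of the earlier ones, so the arch
    next to the first crossing comes last and has to be moved to the top. Dually, the bowl next to
    the first crossing comes first and is moved to the bottom.\<close>
  have arches: "teq 2 (4 + 2 * m) (replicate (Suc m) (1, Arch)) ((1, Arch) # replicate m (3, Arch))"
    using teq_sym[OF layer_commute[OF A(5)[of 1], of 1 Arch]]
    by (simp add: replicate_append_same numeral_eq_Suc)
  have bowls: "teq (4 + 2 * m) 2 (replicate (Suc m) (1, Bowl)) (replicate m (3, Bowl) @ [(1, Bowl)])"
    using layer_commute[OF A(6)[of 1], of 1 Bowl] by (simp add: numeral_eq_Suc)
  have cross: "teq 4 (4 + 2 * m) (replicate m (3, Arch) @ [(0, Cross b)]) ((0, Cross b) # replicate m (3, Arch))"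
    using teq_sym[OF layer_commute[OF A(1)[of 1], of 0 "Cross b"]] by (simp add: numeral_eq_Suc)
  have "teq 2 2 (replicate (Suc m) (1, Arch) @ (((0, Cross b) # C) @ replicate (Suc m) (1, Bowl)))
     (((1, Arch) # replicate m (3, Arch)) @ (((0, Cross b) # C) @ (replicate m (3, Bowl) @ [(1, Bowl)])))"
    by (intro teq_append[OF arches] teq_append[OF _ bowls] teq_refl) (use C in \<open>auto simp: numeral_eq_Suc\<close>)
  moreover have "teq 2 2 ([(1, Arch)] @ ((replicate m (3, Arch) @ [(0, Cross b)]) @ (C @ (replicate m (3, Bowl) @ [(1, Bowl)]))))
     ([(1, Arch)] @ (((0, Cross b) # replicate m (3, Arch)) @ (C @ (replicate m (3, Bowl) @ [(1, Bowl)]))))"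
  proof (intro teq_append[OF teq_refl teq_append[OF cross]] teq_refl)
    have "tangle (4 + 2 * m) (replicate m (3, Bowl)) 4" "tangle 4 [(1, Bowl)] 2"
      using A(4)[of 1] by simp_all
    with C show "tangle (4 + 2 * m) (C @ (replicate m (3, Bowl) @ [(1, Bowl)])) 2"
      using tangle_append by blast
  qed auto
  ultimately show ?thesis
    using m by (simp add: flat_row_def hcons_def row_crossings_Cons C_def) (rule teq_trans)
qed

lemma flat_row_hrow: "row \<noteq> [] \<Longrightarrow> teq 2 2 (flat_row row) (hrow row)"
proof (induction row rule: list_nonempty_induct)
  case (single b)
  then show ?case using teq_sym[OF hrow_single] by (simp add: flat_row_def row_crossings_def)
next
  case (cons b row)
  then show ?case using teq_trans[OF flat_row_Cons hcons_cong] by simp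
qed

text \<open>Conway's denominator closure: the two left ends are joined around the left side and the
  two right ends around the right side.\<close>

definition close_tangle :: "layer list \<Rightarrow> layer list" where
  "close_tangle X = [(0, Arch), (2, Arch)] @ shift 1 X @ [(0, Bowl), (0, Bowl)]"

lemma close_tangle_cong: "teq 2 2 X Y \<Longrightarrow> teq 0 0 (close_tangle X) (close_tangle Y)"
  unfolding close_tangle_def by (rule teq_in_context[of 2 2 _ _ _ _ _ 1]) auto

lemma tangle_column: "tangle 2 (column col) 2"
  by (rule tangle_crosses) (auto simp: column_def)

lemma free_diagram_teq:
  assumes "row \<noteq> []"
  shows "teq 0 0 (free_diagram col row) (close_tangle (column col @ hrow row))"
proof -
  have "free_diagram col row = close_tangle (column col @ flat_row row)"
    by (simp add: free_diagram_def close_tangle_def column_def flat_row_def row_crossings_def shift_def)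
  then show ?thesis
    using close_tangle_cong teq_append[OF teq_refl[OF tangle_column] flat_row_hrow[OF assms]] by simp
qed

section \<open>Reduction to twist tangles\<close>

fun twist :: "bool list \<Rightarrow> int" where
  "twist [] = 0"
| "twist (b # bs) = (if b then 1 else - 1) + twist bs"

text \<open>The normal form of a word under cancellation of neighbouring opposite letters.\<close>

definition twist_word :: "int \<Rightarrow> bool list" where
  "twist_word t = replicate (nat \<bar>t\<bar>) (t > 0)"

text \<open>A letter put in front of a reduced word either prolongs it or cancels its first letter.
  The relation \<open>R\<close> is abstract so that columns, where \<open>R2\<close> cancels, and
  rows, where \<open>hcons_cancel\<close> does, share the argument.\<close>

lemma twist_reduction:
  assumes refl: "\<And>xs. R xs xs" and trans: "\<And>xs ys zs. R xs ys \<Longrightarrow> R ys zs \<Longrightarrow> R xs zs"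
    and cons: "\<And>b xs ys. R xs ys \<Longrightarrow> R (b # xs) (b # ys)"
    and cancel: "\<And>b xs. R (b # (\<not> b) # xs) xs"
  shows "R xs (twist_word (twist xs))"
proof (induction xs)
  case Nil
  show ?case using refl by (simp add: twist_word_def)
next
  case (Cons b xs)
  let ?t = "twist xs"
  have "R (b # twist_word ?t) (twist_word (twist (b # xs)))"
  proof (cases "?t = 0 \<or> (?t > 0) = b")
    case True
    then have "nat \<bar>twist (b # xs)\<bar> = Suc (nat \<bar>?t\<bar>)" "(twist (b # xs) > 0) = b" by auto
    then show ?thesis using True refl by (auto simp: twist_word_def)
  next
    case False
    then obtain m where m: "nat \<bar>?t\<bar> = Suc m" by (cases "nat \<bar>?t\<bar>") auto
    then have "nat \<bar>twist (b # xs)\<bar> = m" "m > 0 \<Longrightarrow> (twist (b # xs) > 0) = (\<not> b)" using False by auto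
    then have "twist_word (twist (b # xs)) = replicate m (\<not> b)" by (cases "m = 0") (auto simp: twist_word_def)
    moreover have "twist_word ?t = (\<not> b) # replicate m (\<not> b)" using False m by (auto simp: twist_word_def)
    ultimately show ?thesis using cancel by simp
  qed
  then show ?case using trans cons[OF Cons] by blast
qed

lemma column_reduction: "teq 2 2 (column xs) (column (twist_word (twist xs)))"
proof (rule twist_reduction)
  fix b xs ys
  show "teq 2 2 (column (b # (\<not> b) # xs)) (column xs)"
    using teq_append[OF teq_local[OF local_move.R2[of 0 b], of 2 2] teq_refl[OF tangle_column[of xs]]]
    by (simp add: column_def)
  show "teq 2 2 (column (b # xs)) (column (b # ys))" if "teq 2 2 (column xs) (column ys)"
    using teq_append[OF teq_refl that, of 2 "[(0, Cross b)]"] by (simp add: column_def)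
qed (rule teq_refl[OF tangle_column], erule (1) teq_trans)

lemma hrow_reduction: "teq 2 2 (hrow xs) (hrow (twist_word (twist xs)))"
proof (rule twist_reduction)
  show "teq 2 2 (hrow (b # xs)) (hrow (b # ys))" if "teq 2 2 (hrow xs) (hrow ys)" for b xs ys
    using hcons_cong[OF that] by simp
  show "teq 2 2 (hrow (b # (\<not> b) # xs)) (hrow xs)" for b xs
    using hcons_cancel[OF tangle_hrow] by simp
qed (rule teq_refl[OF tangle_hrow], erule (1) teq_trans)

section \<open>Assignments that produce the unknot\<close>

text \<open>The bowl of the empty row caps the column, whose crossings are then removed as kinks
  from the bottom up. What remains is a circle with two zigzags.\<close>

lemma unknot_zero_row: "teq 0 0 (close_tangle (column col @ hrow [])) trivial_diagram"
proof -
  have "teq 2 0 (column col @ [(0, Bowl)]) [(0, Bowl)]"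
  proof (induction col)
    case Nil
    then show ?case by (auto simp: column_def intro: teq_refl)
  next
    case (Cons b col)
    have "teq 2 0 (column (b # col) @ [(0, Bowl)]) [(0, Cross b), (0, Bowl)]"
      using teq_append[OF teq_refl Cons, of 2 "[(0, Cross b)]"] by (simp add: column_def)
    then show ?case using teq_trans cross_bowl by metis
  qed
  from teq_append[OF this teq_refl, of "[(0, Arch)]" 2]
  have "teq 2 2 (column col @ hrow []) [(0, Bowl), (0, Arch)]" by simp
  then have "teq 0 0 (close_tangle (column col @ hrow [])) [(0, Arch), (2, Arch), (1, Bowl), (1, Arch), (0, Bowl), (0, Bowl)]"
    by (auto dest: close_tangle_cong simp: close_tangle_def)
  also have "teq 0 0 \<dots> [(0, Arch), (1, Arch), (0, Bowl), (0, Bowl)]"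
    by (rule teq_step[of "[(2, Arch), (1, Bowl)]" "[]" _ "[(0, Arch)]" "[(1, Arch), (0, Bowl), (0, Bowl)]"])
      (auto intro: local_moves)
  also have "teq 0 0 \<dots> trivial_diagram"
    by (rule teq_step[of "[(1, Arch), (0, Bowl)]" "[]" _ "[(0, Arch)]" "[(0, Bowl)]"])
      (auto intro: local_moves simp: trivial_diagram_def)
  finally show ?thesis .
qed

lemma unknot_clasp: "teq 0 0 (close_tangle (column [b] @ hrow [\<not> b, \<not> b])) trivial_diagram"
proof -
  let ?c = "Cross (\<not> b)"
  have "teq 2 2 (column [b] @ hrow [\<not> b, \<not> b]) ([(0, Cross b)] @ hcons (\<not> b) [(0, ?c)])"
    using teq_append[OF teq_refl hcons_cong[OF hrow_single], of 2 "column [b]" "\<not> b" "\<not> b"]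
    by (simp add: column_def)
  also have "teq 2 2 \<dots> [(0, Cross b), (0, Arch), (1, Cross b), (2, ?c), (1, Bowl)]"
    by (rule teq_step[of "[(1, Arch), (0, ?c)]" "[(0, Arch), (1, Cross b)]" _ "[(0, Cross b)]" "[(2, ?c), (1, Bowl)]"])
      (auto intro: local_moves simp: hcons_def)
  also have "teq 2 2 \<dots> [(0, Arch), (2, Cross b), (1, Cross b), (2, ?c), (1, Bowl)]"
    by (rule teq_step[of "[(0, Cross b), (0, Arch)]" "[(0, Arch), (2, Cross b)]" _ "[]" "[(1, Cross b), (2, ?c), (1, Bowl)]"])
      (auto intro: local_moves)
  \<comment> \<open>The third Reidemeister move. The slide has turned the first row crossing into
    \<open>Cross b\<close>, equal to the column crossing, so the pattern is not cyclic. This is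
    where the opposite choices in column and row matter.\<close>
  also have "teq 2 2 \<dots> [(0, Arch), (1, ?c), (2, Cross b), (1, Cross b), (1, Bowl)]"
    by (rule teq_step[of "[(2, Cross b), (1, Cross b), (2, ?c)]" "[(1, ?c), (2, Cross b), (1, Cross b)]" _
          "[(0, Arch)]" "[(1, Bowl)]"])
      (auto intro: local_moves)
  also have "teq 2 2 \<dots> [(0, Arch), (1, ?c), (2, Cross b), (1, Bowl)]"
    using teq_in_context[OF cross_bowl, of 2 "[(0, Arch), (1, ?c), (2, Cross b)]" 1 1 "[]" 2 b] by simp
  also have "teq 2 2 \<dots> [(0, Arch), (1, ?c), (1, ?c), (2, Bowl)]"
    by (rule teq_step[of "[(2, Cross b), (1, Bowl)]" "[(1, ?c), (2, Bowl)]" _ "[(0, Arch), (1, ?c)]" "[]"])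
      (auto intro: local_moves)
  finally have "teq 2 2 (column [b] @ hrow [\<not> b, \<not> b]) [(0, Arch), (1, ?c), (1, ?c), (2, Bowl)]" .
  note clasp = close_tangle_cong[OF this]
  have "close_tangle [(0, Arch), (1, ?c), (1, ?c), (2, Bowl)] =
    [(0, Arch), (2, Arch), (1, Arch), (2, ?c), (2, ?c), (3, Bowl), (0, Bowl), (0, Bowl)]"
    by (simp add: close_tangle_def)
  with clasp have "teq 0 0 (close_tangle (column [b] @ hrow [\<not> b, \<not> b]))
    [(0, Arch), (2, Arch), (1, Arch), (2, ?c), (2, ?c), (3, Bowl), (0, Bowl), (0, Bowl)]"
    by (simp only:)
  \<comment> \<open>The maximum of the right outer arc sinks until it cancels with the bowl at
    position 3. Then the two crossings move below the first of the closing bowls, which frees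
    another zigzag and leaves a circle with two kinks.\<close>
  also have "teq 0 0 \<dots> [(0, Arch), (1, Arch), (4, Arch), (2, ?c), (2, ?c), (3, Bowl), (0, Bowl), (0, Bowl)]"
    by (rule teq_step[of "[(2, Arch), (1, Arch)]" "[(1, Arch), (4, Arch)]" _ "[(0, Arch)]"
          "[(2, ?c), (2, ?c), (3, Bowl), (0, Bowl), (0, Bowl)]"])
      (auto intro: local_moves)
  also have "teq 0 0 \<dots> [(0, Arch), (1, Arch), (2, ?c), (4, Arch), (2, ?c), (3, Bowl), (0, Bowl), (0, Bowl)]"
    by (rule teq_step[of "[(4, Arch), (2, ?c)]" "[(2, ?c), (4, Arch)]" _ "[(0, Arch), (1, Arch)]"
          "[(2, ?c), (3, Bowl), (0, Bowl), (0, Bowl)]"])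
      (auto intro: local_moves)
  also have "teq 0 0 \<dots> [(0, Arch), (1, Arch), (2, ?c), (2, ?c), (4, Arch), (3, Bowl), (0, Bowl), (0, Bowl)]"
    by (rule teq_step[of "[(4, Arch), (2, ?c)]" "[(2, ?c), (4, Arch)]" _ "[(0, Arch), (1, Arch), (2, ?c)]"
          "[(3, Bowl), (0, Bowl), (0, Bowl)]"])
      (auto intro: local_moves)
  also have "teq 0 0 \<dots> [(0, Arch), (1, Arch), (2, ?c), (2, ?c), (0, Bowl), (0, Bowl)]"
    by (rule teq_step[of "[(4, Arch), (3, Bowl)]" "[]" _ "[(0, Arch), (1, Arch), (2, ?c), (2, ?c)]"
          "[(0, Bowl), (0, Bowl)]"])
      (auto intro: local_moves)
  also have "teq 0 0 \<dots> [(0, Arch), (1, Arch), (2, ?c), (0, Bowl), (0, ?c), (0, Bowl)]"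
    by (rule teq_step[of "[(2, ?c), (0, Bowl)]" "[(0, Bowl), (0, ?c)]" _ "[(0, Arch), (1, Arch), (2, ?c)]" "[(0, Bowl)]"])
      (auto intro: local_moves)
  also have "teq 0 0 \<dots> [(0, Arch), (1, Arch), (0, Bowl), (0, ?c), (0, ?c), (0, Bowl)]"
    by (rule teq_step[of "[(2, ?c), (0, Bowl)]" "[(0, Bowl), (0, ?c)]" _ "[(0, Arch), (1, Arch)]" "[(0, ?c), (0, Bowl)]"])
      (auto intro: local_moves)
  also have "teq 0 0 \<dots> [(0, Arch), (0, ?c), (0, ?c), (0, Bowl)]"
    by (rule teq_step[of "[(1, Arch), (0, Bowl)]" "[]" _ "[(0, Arch)]" "[(0, ?c), (0, ?c), (0, Bowl)]"])
      (auto intro: local_moves)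
  also have "teq 0 0 \<dots> [(0, Arch), (0, ?c), (0, Bowl)]"
    using teq_in_context[OF cross_bowl, of 0 "[(0, Arch), (0, ?c)]" 0 0 "[]" 0 "\<not> b"] by simp
  also have "teq 0 0 \<dots> trivial_diagram"
    using teq_in_context[OF cross_bowl, of 0 "[(0, Arch)]" 0 0 "[]" 0 "\<not> b"] by (simp add: trivial_diagram_def)
  finally show ?thesis .
qed

lemma free_diagram_unknot:
  assumes "row \<noteq> []" "twist row = 0 \<or> twist col * twist row = - 2" "odd (twist col)"
  shows "teq 0 0 (free_diagram col row) trivial_diagram"
proof -
  have *: "teq 0 0 (free_diagram col row)
      (close_tangle (column (twist_word (twist col)) @ hrow (twist_word (twist row))))"
    using teq_trans[OF free_diagram_teq[OF assms(1)]
        close_tangle_cong[OF teq_append[OF column_reduction hrow_reduction]]] .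
  show ?thesis
  proof (cases "twist row = 0")
    case True
    then have "twist_word (twist row) = []" by (simp add: twist_word_def)
    then show ?thesis using teq_trans[OF *] unknot_zero_row by metis
  next
    case False
    then have "twist col dvd 2" using assms(2) by (metis dvd_minus_iff dvd_triv_left)
    then have "\<bar>twist col\<bar> \<le> 2" by (simp add: zdvd_imp_le)
    then have "twist col = 1 \<or> twist col = - 1"
      using assms(3) by presburger
    then have "twist col = 1 \<and> twist row = - 2 \<or> twist col = - 1 \<and> twist row = 2"
      using assms(2) False by auto
    \<comment> \<open>The reduced words are now those of \<open>unknot_clasp\<close>, with
      \<open>twist col > 0\<close> in the role of \<open>b\<close>.\<close>
    then have "twist_word (twist col) = [twist col > 0]"
      "twist_word (twist row) = [\<not> twist col > 0, \<not> twist col > 0]"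
      by (auto simp: twist_word_def numeral_2_eq_2)
    then show ?thesis using teq_trans[OF *] unknot_clasp by metis
  qed
qed

section \<open>Colourings by involutory quandles\<close>

text \<open>A kei is an involutory quandle; \<open>q x y\<close> is the colour that \<open>y\<close>
  takes after passing under \<open>x\<close>. The axioms match the first, second and third
  Reidemeister moves, and involutivity makes orientations of the strands unnecessary.\<close>

locale kei =
  fixes q :: "'a \<Rightarrow> 'a \<Rightarrow> 'a"
  assumes idem [simp]: "q x x = x"
    and invol [simp]: "q x (q x y) = y"
    and distrib: "q x (q y z) = q (q x y) (q x z)"
begin

primrec head_step :: "piece \<Rightarrow> 'a list \<Rightarrow> 'a list \<Rightarrow> bool" where
  "head_step Arch xs ys \<longleftrightarrow> (\<exists>x. ys = x # x # xs)"
| "head_step Bowl xs ys \<longleftrightarrow> (\<exists>x. xs = x # x # ys)"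
| "head_step (Cross b) xs ys \<longleftrightarrow>
    (\<exists>x y zs. xs = x # y # zs \<and> ys = (if b then [q x y, x] else [y, q y x]) @ zs)"

primrec layer_step :: "nat \<Rightarrow> piece \<Rightarrow> 'a list \<Rightarrow> 'a list \<Rightarrow> bool" where
  "layer_step 0 p xs ys \<longleftrightarrow> head_step p xs ys"
| "layer_step (Suc i) p xs ys \<longleftrightarrow> (\<exists>a xs' ys'. xs = a # xs' \<and> ys = a # ys' \<and> layer_step i p xs' ys')"

text \<open>\<open>U\<close> is the set of all colours that occur at some height of the colouring.\<close>

fun colouring :: "layer list \<Rightarrow> 'a list \<Rightarrow> 'a list \<Rightarrow> 'a set \<Rightarrow> bool" where
  "colouring [] xs ys U \<longleftrightarrow> xs = ys \<and> U = set xs"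
| "colouring ((i, p) # D) xs ys U \<longleftrightarrow>
    (\<exists>zs V. layer_step i p xs zs \<and> colouring D zs ys V \<and> U = set xs \<union> V)"

lemma colouring_ends: "colouring D xs ys U \<Longrightarrow> set xs \<subseteq> U \<and> set ys \<subseteq> U"
  by (induction D xs ys U rule: colouring.induct) auto

lemma colouring_append:
  "colouring (D @ E) xs ys U \<longleftrightarrow>
    (\<exists>zs V W. colouring D xs zs V \<and> colouring E zs ys W \<and> U = V \<union> W)"
proof (induction D arbitrary: xs U)
  case Nil
  have "set xs \<union> W = W" if "colouring E xs ys W" for W
    using colouring_ends[OF that] by blast
  then show ?case by (auto simp del: Un_iff)
next
  case (Cons x D)
  obtain i p where x: "x = (i, p)" by (cases x)
  have "colouring (x # D @ E) xs ys U \<longleftrightarrow> (\<exists>us zs V W. layer_step i p xs us \<and> colouring D us zs V \<and>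
      colouring E zs ys W \<and> U = set xs \<union> (V \<union> W))"
    unfolding x colouring.simps Cons.IH by blast
  moreover have "(\<exists>zs V W. colouring (x # D) xs zs V \<and> colouring E zs ys W \<and> U = V \<union> W) \<longleftrightarrow>
     (\<exists>us zs V W. layer_step i p xs us \<and> colouring D us zs V \<and>
      colouring E zs ys W \<and> U = (set xs \<union> V) \<union> W)"
    unfolding x colouring.simps by blast
  ultimately show ?case by (simp add: Un_assoc)
qed

lemma layer_step_length:
  "layer_step i p xs ys \<Longrightarrow> ins p \<le> length xs \<and> length ys = length xs - ins p + outs p"
proof (induction i arbitrary: xs ys)
  case 0
  then show ?case
  proof (cases p)
    case (Cross b)
    with 0 show ?thesis by (cases b) auto
  qed auto
next
  case (Suc i)
  then obtain a xs' ys' where "xs = a # xs'" "ys = a # ys'" "layer_step i p xs' ys'" by auto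
  with Suc.IH[of xs' ys'] show ?case by (simp add: Suc_diff_le)
qed

lemma colouring_length: "colouring D xs ys U \<Longrightarrow> tangle (length xs) D n \<Longrightarrow> length ys = n"
  by (induction D xs ys U rule: colouring.induct) (auto dest: layer_step_length)

lemma colouring_shift_Suc: "colouring (shift (Suc 0) D) (a # xs) ys U \<longleftrightarrow>
  (\<exists>ys' V. ys = a # ys' \<and> U = insert a V \<and> colouring D xs ys' V)"
proof (induction D arbitrary: xs U)
  case (Cons x D)
  obtain i p where x: "x = (i, p)" by (cases x)
  have step: "layer_step (Suc 0 + i) p (a # xs) zs \<longleftrightarrow> (\<exists>zs'. zs = a # zs' \<and> layer_step i p xs zs')" for zs
    by auto
  have "colouring (shift (Suc 0) (x # D)) (a # xs) ys U \<longleftrightarrow>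
    (\<exists>zs' V. layer_step i p xs zs' \<and> colouring (shift (Suc 0) D) (a # zs') ys V \<and> U = insert a (set xs) \<union> V)"
    unfolding x shift_simps colouring.simps step list.set by metis
  also have "\<dots> \<longleftrightarrow> (\<exists>zs' ys' V. layer_step i p xs zs' \<and> ys = a # ys' \<and> colouring D zs' ys' V \<and>
      U = insert a (set xs \<union> V))"
    unfolding Cons.IH by (metis Un_insert_left Un_insert_right insert_absorb2)
  also have "\<dots> \<longleftrightarrow> (\<exists>ys' V. ys = a # ys' \<and> U = insert a V \<and> colouring (x # D) xs ys' V)"
    unfolding x colouring.simps by metis
  finally show ?case .
qed auto

lemma layer_step_append: "layer_step i p xs ys \<Longrightarrow> layer_step i p (xs @ zs) (ys @ zs)"
proof (induction i arbitrary: xs ys)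
  case 0
  then show ?case
  proof (cases p)
    case (Cross b)
    with 0 show ?thesis by (cases b) auto
  qed auto
qed auto

lemma colouring_append_strands: "colouring D xs ys U \<Longrightarrow> colouring D (xs @ zs) (ys @ zs) (U \<union> set zs)"
proof (induction D xs ys U rule: colouring.induct)
  case (2 i p D xs ys U)
  then obtain us V where "layer_step i p xs us" "colouring D us ys V" "U = set xs \<union> V" by auto
  then show ?case using 2(1) layer_step_append by (auto intro!: exI[of _ "us @ zs"] exI[of _ "V \<union> set zs"])
qed auto

section \<open>Invariance of nonconstant colourings under the moves\<close>

text \<open>A local move may change the set of colours; the last clause only says that it keeps a
  nonconstant colouring nonconstant.\<close>

definition refines :: "nat \<Rightarrow> layer list \<Rightarrow> layer list \<Rightarrow> bool" where
  "refines m D E \<longleftrightarrow> (\<forall>xs ys U. length xs = m \<longrightarrow> colouring D xs ys U \<longrightarrow>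
    (\<exists>V. colouring E xs ys V \<and> (\<forall>c. V \<subseteq> {c} \<longrightarrow> U \<subseteq> {c})))"

lemma refines_shift: "refines m D E \<Longrightarrow> refines (k + m) (shift k D) (shift k E)"
proof (induction k)
  case (Suc k)
  have "refines (Suc n) (shift (Suc 0) X) (shift (Suc 0) Y)" if XY: "refines n X Y" for n X Y
    unfolding refines_def
  proof (intro allI impI)
    fix xs ys U assume "length xs = Suc n" and c: "colouring (shift (Suc 0) X) xs ys U"
    then obtain a xs' where xs: "xs = a # xs'" "length xs' = n" by (cases xs) auto
    with c obtain ys' U' where U': "ys = a # ys'" "U = insert a U'" "colouring X xs' ys' U'"
      by (auto simp: colouring_shift_Suc)
    with XY xs obtain V where "colouring Y xs' ys' V" "\<And>c. V \<subseteq> {c} \<Longrightarrow> U' \<subseteq> {c}"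
      unfolding refines_def by blast
    moreover from this(1) have "colouring (shift (Suc 0) Y) xs ys (insert a V)"
      unfolding xs U' colouring_shift_Suc by blast
    ultimately show "\<exists>V. colouring (shift (Suc 0) Y) xs ys V \<and> (\<forall>c. V \<subseteq> {c} \<longrightarrow> U \<subseteq> {c})"
      unfolding U' by (intro exI[of _ "insert a V"]) simp
  qed
  from this[OF Suc.IH[OF Suc.prems]] show ?case by simp
qed simp

lemma q_cancel [simp]: "q x y = q x z \<longleftrightarrow> y = z"
  by (metis invol)

lemma q_eq_self [simp]: "q x y = x \<longleftrightarrow> y = x"
  by (metis idem q_cancel)

lemma eq_q_self: "x = q x y \<longleftrightarrow> y = x"
  by (subst eq_commute) (rule q_eq_self)

definition colourable :: "layer list \<Rightarrow> 'a list \<Rightarrow> 'a list \<Rightarrow> bool" where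
  "colourable D xs ys \<longleftrightarrow> (\<exists>U. colouring D xs ys U)"

lemma colourable_simps [simp]:
  "colourable [] xs ys \<longleftrightarrow> xs = ys"
  "colourable ((i, p) # D) xs ys \<longleftrightarrow> (\<exists>zs. layer_step i p xs zs \<and> colourable D zs ys)"
  by (auto simp: colourable_def)

text \<open>With this property, nonconstant colours inside a small diagram are already visible at
  its ends, so that for a local move only the colours at the ends have to be compared.\<close>

definition end_determined :: "layer list \<Rightarrow> bool" where
  "end_determined D \<longleftrightarrow> (\<forall>xs ys U c. colouring D xs ys U \<and> set xs \<union> set ys \<subseteq> {c} \<longrightarrow> U \<subseteq> {c})"

text \<open>The end colours are common to both diagrams and belong to \<open>V\<close>. If
  \<open>V\<close> is constant, so are the ends of \<open>D\<close>, and hence all of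
  \<open>U\<close>.\<close>

lemma refinesI:
  assumes "end_determined D" "\<And>xs ys. length xs = m \<Longrightarrow> colourable D xs ys \<Longrightarrow> colourable E xs ys"
  shows "refines m D E"
  unfolding refines_def
proof (intro allI impI)
  fix xs ys U assume "length xs = m" and U: "colouring D xs ys U"
  then obtain V where V: "colouring E xs ys V" using assms(2) unfolding colourable_def by blast
  have "U \<subseteq> {c}" if "V \<subseteq> {c}" for c
    using assms(1) U colouring_ends[OF V] that unfolding end_determined_def by (meson Un_least order_trans)
  with V show "\<exists>V. colouring E xs ys V \<and> (\<forall>c. V \<subseteq> {c} \<longrightarrow> U \<subseteq> {c})" by blast
qed

text \<open>No side of a local move contains a closed component, and by idempotence a crossing of
  two strands of equal colour creates no new colour.\<close>

lemma end_determined_moves: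
  "end_determined []"
  "end_determined [(0, Arch), (Suc 0, Bowl)]"
  "end_determined [(Suc 0, Arch), (0, Bowl)]"
  "end_determined [(0, Arch), (Suc 0, Cross b)]"
  "end_determined [(Suc 0, Arch), (0, Cross b)]"
  "end_determined [(0, Cross b), (Suc 0, Bowl)]"
  "end_determined [(Suc 0, Cross b), (0, Bowl)]"
  "end_determined [(Suc 0, Arch), (0, Cross b), (Suc 0, Bowl)]"
  "end_determined [(0, Arch), (Suc 0, Cross b), (0, Bowl)]"
  "end_determined [(0, Cross b), (0, Cross c)]"
  "end_determined [(0, Cross a), (Suc 0, Cross b), (0, Cross c)]"
  "end_determined [(Suc 0, Cross a), (0, Cross b), (Suc 0, Cross c)]"
  unfolding end_determined_def by (auto split: if_splits)

lemma end_determined_exchange: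
  "end_determined [(0, p), (outs p + j, r)]" "end_determined [(ins p + j, r), (0, p)]"
  unfolding end_determined_def by (cases p; auto split: if_splits)+

lemma colourable_exchange:
  "colourable [(0, p), (outs p + j, r)] xs ys \<longleftrightarrow> colourable [(ins p + j, r), (0, p)] xs ys"
proof (cases p)
  case (Cross b)
  then show ?thesis by (cases b) auto
qed (auto, blast)

lemma layer_step_Cons [simp]:
  "layer_step 0 (Cross True) (x # y # zs) us \<longleftrightarrow> us = q x y # x # zs"
  "layer_step 0 (Cross False) (x # y # zs) us \<longleftrightarrow> us = y # q y x # zs"
  "layer_step 0 Bowl (x # y # zs) us \<longleftrightarrow> x = y \<and> us = zs"
  "layer_step (Suc i) p (x # xs) us \<longleftrightarrow> (\<exists>vs. us = x # vs \<and> layer_step i p xs vs)"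
  by auto

text \<open>The bowl imposes an equation on the colour \<open>c\<close> of the loop, and by
  idempotence its only solution is \<open>c = x\<close>.\<close>

lemma colourable_R1_left:
  "colourable [(0, Arch), (Suc 0, Cross b), (0, Bowl)] (x # xs) ys \<longleftrightarrow> x # xs = ys"
proof -
  have "colourable [(0, Arch), (Suc 0, Cross b), (0, Bowl)] (x # xs) ys \<longleftrightarrow>
    (\<exists>c. colourable [(Suc 0, Cross b), (0, Bowl)] (c # c # x # xs) ys)"
    by (auto simp: colourable_simps(2)[of 0 Arch] simp del: colourable_simps(2))
  also have "\<dots> \<longleftrightarrow> (\<exists>c. (if b then q c x else x) = c \<and> (if b then c else q x c) # xs = ys)"
    by (intro ex_cong1) (cases b; simp add: eq_q_self)
  also have "\<dots> \<longleftrightarrow> x # xs = ys"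
    by (cases b; simp add: eq_q_self)
  finally show ?thesis .
qed

lemma colourable_R1_right:
  "colourable [(Suc 0, Arch), (0, Cross b), (Suc 0, Bowl)] (x # xs) ys \<longleftrightarrow> x # xs = ys"
proof -
  have "layer_step (Suc 0) Arch (x # xs) zs \<longleftrightarrow> (\<exists>c. zs = x # c # c # xs)" for zs
    by auto
  then have "colourable [(Suc 0, Arch), (0, Cross b), (Suc 0, Bowl)] (x # xs) ys \<longleftrightarrow>
    (\<exists>c. colourable [(0, Cross b), (Suc 0, Bowl)] (x # c # c # xs) ys)"
    by (simp only: colourable_simps(2)[of "Suc 0" Arch]) metis
  also have "\<dots> \<longleftrightarrow> (\<exists>c. ys = (if b then q x c else c) # xs \<and> (if b then c = x else x = c))"
    by (intro ex_cong1) (cases b; simp add: eq_q_self)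
  also have "\<dots> \<longleftrightarrow> x # xs = ys"
    by (cases b; simp add: eq_q_self; rule eq_commute)
  finally show ?thesis .
qed

lemma colourable_slide_Arch:
  "colourable [(0, Arch), (Suc 0, Cross b)] xs ys \<longleftrightarrow>
    colourable [(Suc 0, Arch), (0, Cross (\<not> b))] xs ys"
proof (cases xs)
  case (Cons x r)
  have "colourable [(0, Arch), (Suc 0, Cross b)] (x # r) ys \<longleftrightarrow>
    (\<exists>c. colourable [(Suc 0, Cross b)] (c # c # x # r) ys)"
    by (simp only: colourable_simps(2)[of 0 Arch] layer_step.simps(1) head_step.simps(1)) metis
  \<comment> \<open>If \<open>x\<close> is the overstrand, an arch coloured \<open>c\<close> on one
    side corresponds to an arch coloured \<open>q x c\<close> on the other, a bijection by
    \<open>invol\<close>. Otherwise the colour of the arch stays the same.\<close>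
  also have "\<dots> \<longleftrightarrow> (\<exists>c. colourable [(0, Cross (\<not> b))] (x # c # c # r) ys)"
    by (cases b; simp; metis invol)
  also have "\<dots> \<longleftrightarrow> colourable [(Suc 0, Arch), (0, Cross (\<not> b))] (x # r) ys"
    by (simp only: colourable_simps(2)[of "Suc 0" Arch] layer_step_Cons layer_step.simps(1) head_step.simps(1)) metis
  finally show ?thesis by (simp only: Cons)
qed (cases b; auto)

lemma colourable_slide_Bowl:
  "colourable [(0, Cross b), (Suc 0, Bowl)] xs ys \<longleftrightarrow>
    colourable [(Suc 0, Cross (\<not> b)), (0, Bowl)] xs ys"
proof (cases "\<exists>x y z r. xs = x # y # z # r")
  case True
  then obtain x y z r where "xs = x # y # z # r" by blast
  then show ?thesis by (cases b; simp; metis invol)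
next
  case False
  then have "xs = [] \<or> (\<exists>x. xs = [x]) \<or> (\<exists>x y. xs = [x, y])" by (metis list.exhaust)
  then show ?thesis by (cases b) auto
qed

lemma colourable_R2:
  "colourable [(0, Cross b), (0, Cross (\<not> b))] (x # y # xs) ys \<longleftrightarrow> x # y # xs = ys"
  by (cases b; simp; rule eq_commute)

text \<open>Distributing \<open>q y\<close> over the inner product produces
  \<open>q y (q y x)\<close>, which \<open>invol\<close> turns into \<open>x\<close>.\<close>

lemma distrib_invol: "q y (q (q y x) z) = q x (q y z)"
  by (metis distrib invol)

lemma colourable_R3:
  assumes "a = b \<or> b = c"
  shows "colourable [(0, Cross a), (Suc 0, Cross b), (0, Cross c)] xs ys \<longleftrightarrow>
     colourable [(Suc 0, Cross c), (0, Cross b), (Suc 0, Cross a)] xs ys"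
proof (cases "\<exists>x y z r. xs = x # y # z # r")
  case True
  then obtain x y z r where "xs = x # y # z # r" by blast
  then show ?thesis using assms by (cases a; cases b; cases c; simp add: distrib[symmetric] distrib_invol)
next
  case False
  then have "xs = [] \<or> (\<exists>x. xs = [x]) \<or> (\<exists>x y. xs = [x, y])" by (metis list.exhaust)
  then show ?thesis by (cases a; cases b; cases c; auto)
qed

lemma colourable_zigzag_left:
  "colourable [(0, Arch), (Suc 0, Bowl)] (x # xs) ys \<longleftrightarrow> x # xs = ys"
  by auto

lemma colourable_zigzag_right:
  "colourable [(Suc 0, Arch), (0, Bowl)] (x # xs) ys \<longleftrightarrow> x # xs = ys"
  by auto

lemma refines_shifted:
  assumes "end_determined D" "end_determined E"
    and "\<And>xs ys. length xs = m \<Longrightarrow> colourable D xs ys \<longleftrightarrow> colourable E xs ys"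
  shows "refines (k + m) (shift k D) (shift k E) \<and> refines (k + m) (shift k E) (shift k D)"
  using assms by (auto intro!: refines_shift refinesI)

lemma refines_shifted_Nil:
  assumes "end_determined D" "\<And>x xs ys. colourable D (x # xs) ys \<longleftrightarrow> x # xs = ys"
  shows "refines (k + Suc m) (shift k D) [] \<and> refines (k + Suc m) [] (shift k D)"
proof -
  have "colourable D xs ys \<longleftrightarrow> colourable [] xs ys" if "length xs = Suc m" for xs ys
    using that assms(2) by (cases xs) simp_all
  from refines_shifted[where m = "Suc m" and k = k, OF assms(1) end_determined_moves(1) this] show ?thesis by simp
qed

text \<open>Each move is a translate by \<open>i\<close> of the same move at position 0. Splitting
  off the \<open>i\<close> strands on the left reduces every case to the colour computations above,
  with \<open>l\<close> or a successor of it counting the other strands.\<close>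

lemma local_move_refines:
  assumes "local_move D E" "tangle m D n" "tangle m E n'"
  shows "refines m D E \<and> refines m E D"
  using assms
proof (induction rule: local_move.induct)
  case (exchange i p j r)
  define j' l where "j' = j - i - outs p" and "l = m - i"
  then have "j = i + (outs p + j')" "m = i + l" using exchange by auto
  then show ?case
    using refines_shifted[where m = l and k = i, OF end_determined_exchange[of p j' r] colourable_exchange]
    by (simp add: add.commute add.left_commute)
next
  case (zigzag_left i)
  then obtain l where "m = i + Suc l" using less_imp_Suc_add[of i m] by auto
  then show ?case
    using refines_shifted_Nil[OF end_determined_moves(2) colourable_zigzag_left, of i l] by simp
next
  case (zigzag_right i)
  then obtain l where "m = i + Suc l" using less_imp_Suc_add[of i m] by auto
  then show ?case
    using refines_shifted_Nil[OF end_determined_moves(3) colourable_zigzag_right, of i l] by simp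
next
  case (slide_Arch i b)
  then obtain l where "m = i + l" using le_Suc_ex[of i m] by auto
  then show ?case
    using refines_shifted[where m = l and k = i, OF end_determined_moves(4,5) colourable_slide_Arch] by simp
next
  case (slide_Bowl i b)
  then obtain l where "m = i + l" using le_Suc_ex[of i m] by auto
  then show ?case
    using refines_shifted[where m = l and k = i, OF end_determined_moves(6,7) colourable_slide_Bowl] by simp
next
  case (R1_right i b)
  then obtain l where "m = i + Suc l" using less_imp_Suc_add[of i m] by auto
  then show ?case
    using refines_shifted_Nil[OF end_determined_moves(8) colourable_R1_right, of i l] by simp
next
  case (R1_left i b)
  then obtain l where "m = i + Suc l" using less_imp_Suc_add[of i m] by auto
  then show ?case
    using refines_shifted_Nil[OF end_determined_moves(9) colourable_R1_left, of i l] by simp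
next
  case (R2 i b)
  then obtain l where "m = i + Suc (Suc l)" using le_Suc_ex[of "i + 2" m] by auto
  have R2_Nil: "colourable [(0, Cross b), (0, Cross (\<not> b))] xs ys \<longleftrightarrow> colourable [] xs ys"
    if xs: "length xs = Suc (Suc l)" for xs ys
  proof -
    obtain x y zs where "xs = x # y # zs" using xs by (metis length_Suc_conv)
    then show ?thesis using colourable_R2 by (simp only: colourable_simps(1))
  qed
  from \<open>m = i + Suc (Suc l)\<close> show ?case
    using refines_shifted[where m = "Suc (Suc l)" and k = i, OF end_determined_moves(10,1) R2_Nil] by simp
next
  case (R3 a b c i)
  then obtain l where "m = i + l" using le_Suc_ex[of i m] by auto
  then show ?case
    using refines_shifted[where m = l and k = i, OF end_determined_moves(11,12) colourable_R3[OF R3(1)]] by simp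
qed

text \<open>Existence of a nonconstant colouring replaces the number of colourings, which would
  carry no information for an infinite kei.\<close>

definition nontrivially_colourable :: "layer list \<Rightarrow> bool" where
  "nontrivially_colourable D \<longleftrightarrow> (\<exists>U. colouring D [] [] U \<and> (\<forall>c. \<not> U \<subseteq> {c}))"

lemma nontrivially_colourable_teq:
  assumes "teq 0 0 X Y"
  shows "nontrivially_colourable X \<longleftrightarrow> nontrivially_colourable Y"
proof -
  \<comment> \<open>The parts above and below keep their colouring, and a union is constant only if
    each of its parts is, so a refinement of the middle part suffices.\<close>
  have refined: "nontrivially_colourable (A @ E @ B)"
    if nc: "nontrivially_colourable (A @ D @ B)" and A: "tangle 0 A m" and DE: "refines m D E" for A B D E m
  proof -
    obtain xs ys U V W where U: "colouring A [] xs U" and V: "colouring D xs ys V"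
      and W: "colouring B ys [] W" and UVW: "\<And>c. \<not> U \<union> V \<union> W \<subseteq> {c}"
      using nc unfolding nontrivially_colourable_def colouring_append by (metis Un_assoc)
    have "length xs = m" using colouring_length[OF U] A by simp
    then obtain V' where "colouring E xs ys V'" "\<And>c. V' \<subseteq> {c} \<Longrightarrow> V \<subseteq> {c}"
      using DE V unfolding refines_def by blast
    then have "colouring (A @ E @ B) [] [] (U \<union> (V' \<union> W))" "\<And>c. \<not> U \<union> (V' \<union> W) \<subseteq> {c}"
      using U W UVW unfolding colouring_append by (blast, simp)
    then show ?thesis unfolding nontrivially_colourable_def by blast
  qed
  have move: "nontrivially_colourable X \<longleftrightarrow> nontrivially_colourable Y" if "tangle_move 0 0 X Y" for X Y
    using that
  proof cases
    case (1 D E A B)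
    then obtain m n m' n' where "tangle 0 A m" "tangle m D n" "tangle 0 A m'" "tangle m' E n'"
      by auto
    with 1 local_move_refines refined tangle_unique show ?thesis by metis
  qed
  have "equivclp (tangle_move 0 0) X Y" using assms by (simp add: teq_def)
  then show ?thesis
    by (induction rule: equivclp_induct) (use move in auto)
qed

section \<open>Colourings of columns, rows and their closure\<close>

lemma colourable_shift: "colourable D xs ys \<Longrightarrow> colourable (shift (length zs) D) (zs @ xs) (zs @ ys)"
proof (induction zs)
  case (Cons z zs)
  have "colourable (shift (Suc 0) E) (a # us) (a # vs)" if "colourable E us vs" for E a us vs
    using that unfolding colourable_def colouring_shift_Suc by blast
  from this[OF Cons.IH[OF Cons.prems]] show ?case by simp
qed simp

lemma colourable_append: "colourable D xs ys \<Longrightarrow> colourable E ys zs \<Longrightarrow> colourable (D @ E) xs zs"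
  unfolding colourable_def colouring_append by blast

text \<open>\<open>f\<close> is a homomorphism from the dihedral kei on the integers, so the
  following are Fox colourings, computed with integers and read through \<open>f\<close>.\<close>

context
  fixes f :: "int \<Rightarrow> 'a"
  assumes f: "q (f s) (f t) = f (2 * s - t)"
begin

text \<open>Each crossing translates both colours by the same amount, \<open>t - s\<close> up to
  sign, and thus preserves their difference.\<close>

lemma colourable_column:
  "colourable (column bs) [f s, f t] [f (s - twist bs * (t - s)), f (t - twist bs * (t - s))]"
proof (induction bs arbitrary: s t)
  case Nil
  then show ?case by (simp add: column_def)
next
  case (Cons b bs)
  show ?case
  proof (cases b)
    case True
    then show ?thesis using Cons[of "2 * s - t" s] by (simp add: column_def f algebra_simps)
  next
    case False
    then show ?thesis using Cons[of t "2 * t - s"] by (simp add: column_def f algebra_simps)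
  qed
qed

text \<open>In a row the difference \<open>d\<close> between upper and lower colour is what stays
  constant from left to right, while each crossing adds \<open>d\<close> or \<open>- d\<close> to
  both.\<close>

lemma colourable_hrow:
  "colourable (hrow bs) [f s, f (s + twist bs * d)] [f (s - d), f (s - d + twist bs * d)]"
proof (induction bs arbitrary: s)
  case Nil
  show ?case by (auto intro!: exI[of _ "[]"])
next
  case (Cons b bs)
  define t where "t = s + twist (b # bs) * d"
  \<comment> \<open>The parameter of the arch joining the first crossing to the rest, chosen so that
    the lower left end of the crossing gets \<open>s - d\<close>.\<close>
  define s' where "s' = (if b then s + d else s - d)"
  have t: "t = s' + twist bs * d" by (auto simp: t_def s'_def algebra_simps)
  have c1: "colourable [(1, Arch)] [f s, f t] [f s, f s', f s', f t]"
    by auto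
  have c2: "colourable [(0, Cross b)] [f s, f s', f s', f t] [f (s - d), f (s' - d), f s', f t]"
    by (cases b) (simp_all add: s'_def f algebra_simps)
  have c3: "colourable (shift 2 (hrow bs)) [f (s - d), f (s' - d), f s', f t]
      [f (s - d), f (s' - d), f (s' - d), f (s' - d + twist bs * d)]"
    using colourable_shift[OF Cons[of s'], of "[f (s - d), f (s' - d)]"] by (simp add: t numeral_2_eq_2)
  have c4: "colourable [(1, Bowl)] [f (s - d), f (s' - d), f (s' - d), f (s' - d + twist bs * d)]
      [f (s - d), f (s - d + twist (b # bs) * d)]"
    by (auto simp: s'_def algebra_simps)
  show ?case
    using colourable_append[OF colourable_append[OF c1 c2] colourable_append[OF c3 c4]]
    by (simp only: append.simps hcons_def hrow_simps t_def)
qed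

lemma free_diagram_coloured:
  assumes period: "\<And>s. f (s + (1 + twist row * twist col)) = f s" and "f 0 \<noteq> f 1"
  shows "nontrivially_colourable (close_tangle (column col @ hrow row))"
proof -
  let ?a = "twist col" and ?m = "twist row"
  have "colourable (column col) [f 0, f 1] [f (- ?a), f (1 - ?a)]"
    using colourable_column[of col 0 1] by simp
  \<comment> \<open>Returning to 0 at the lower left end forces \<open>d = - ?a\<close>. The two
    colours on the right then differ from the required ones by \<open>1 + ?m * ?a\<close>, which is
    a period of \<open>f\<close>.\<close>
  moreover have "colourable (hrow row) [f (- ?a), f (1 - ?a)] [f 0, f 1]"
    using colourable_hrow[of row "- ?a" "- ?a"] period[of "- ?a - ?m * ?a"] period[of "- ?m * ?a"]
    by (simp add: algebra_simps)
  ultimately have "colourable (column col @ hrow row) [f 0, f 1] [f 0, f 1]"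
    by (rule colourable_append)
  then obtain U where "colouring (column col @ hrow row) [f 0, f 1] [f 0, f 1] U"
    unfolding colourable_def by blast
  then have "colouring (column col @ hrow row) [f 0, f 1, f 1] [f 0, f 1, f 1] (U \<union> {f 1})"
    using colouring_append_strands[of _ "[f 0, f 1]" _ _ "[f 1]"] by fastforce
  then have "colouring (shift 1 (column col @ hrow row)) [f 0, f 0, f 1, f 1] [f 0, f 0, f 1, f 1]
     (insert (f 0) (U \<union> {f 1}))" (is "colouring ?X ?xs _ ?U")
    unfolding One_nat_def colouring_shift_Suc by blast
  moreover have "colouring [(0, Arch), (2, Arch)] [] ?xs {f 0, f 1}"
    by (auto simp: numeral_2_eq_2)
  moreover have "colouring [(0, Bowl), (0, Bowl)] ?xs [] {f 0, f 1}"
    by auto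
  ultimately have "colouring (close_tangle (column col @ hrow row)) [] [] ({f 0, f 1} \<union> (?U \<union> {f 0, f 1}))"
    unfolding close_tangle_def colouring_append by blast
  moreover have "\<not> {f 0, f 1} \<union> (?U \<union> {f 0, f 1}) \<subseteq> {c}" for c using assms(2) by auto
  ultimately show ?thesis unfolding nontrivially_colourable_def by blast
qed

end

lemma trivial_diagram_not_coloured: "\<not> nontrivially_colourable trivial_diagram"
  by (auto simp: nontrivially_colourable_def trivial_diagram_def)

end

section \<open>Assignments that do not produce the unknot\<close>

text \<open>The case \<open>x = 0\<close> is chosen such that the quandle axioms hold on the whole field.\<close>

definition rotation :: "complex \<Rightarrow> complex \<Rightarrow> complex" where
  "rotation x y = (if x = 0 then y else x ^ 2 / y)"

interpretation rotation: kei rotation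
  by unfold_locales (auto simp: rotation_def field_simps power2_eq_square)

lemma free_diagram_not_unknot:
  assumes "row \<noteq> []" "\<bar>1 + twist row * twist col\<bar> \<ge> 2"
  shows "\<not> teq 0 0 (free_diagram col row) trivial_diagram"
proof -
  define d where "d = 1 + twist row * twist col"
  define N where "N = nat \<bar>d\<bar>"
  \<comment> \<open>The colours are the powers of a root of unity \<open>z\<close> other than 1. In
    this way the single kei on the complex numbers serves all moduli \<open>N\<close>.\<close>
  have "card {z :: complex. z ^ N = 1} = N"
    using assms(2) by (intro card_roots_unity_eq) (auto simp: N_def d_def)
  moreover have "N \<ge> 2" using assms(2) by (simp add: N_def d_def)
  ultimately have "\<not> {z :: complex. z ^ N = 1} \<subseteq> {1}"
    using card_mono[of "{1 :: complex}" "{z. z ^ N = 1}"] by auto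
  then obtain z :: complex where z: "z ^ N = 1" "z \<noteq> 1" by auto
  then have "z \<noteq> 0" using \<open>N \<ge> 2\<close> by (auto simp: power_0_left)
  have "d = int N \<or> d = - int N" by (auto simp: N_def)
  then have d: "z powi d = 1" using z by (auto simp: power_int_minus)
  have "rotation (z powi s) (z powi t) = z powi (2 * s - t)" for s t
    using \<open>z \<noteq> 0\<close> by (simp add: rotation_def power_int_diff power_int_mult mult.commute[of 2])
  then have "rotation.nontrivially_colourable (close_tangle (column col @ hrow row))"
    by (rule rotation.free_diagram_coloured)
      (use d z \<open>z \<noteq> 0\<close> in \<open>auto simp: power_int_add simp flip: d_def\<close>)
  then show ?thesis
    using rotation.nontrivially_colourable_teq[OF teq_trans[OF teq_sym[OF free_diagram_teq[OF assms(1)]]]]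
      rotation.trivial_diagram_not_coloured by blast
qed

lemma produces_unknot_iff:
  assumes "row \<noteq> []" "odd (twist col)" "even (twist row)"
  shows "produces_unknot (free_diagram col row) \<longleftrightarrow> twist row = 0 \<or> twist col * twist row = - 2"
proof -
  have link: "link_diagram (free_diagram col row)"
    using free_diagram_teq[OF assms(1), of col] by (simp add: teq_def link_diagram_def)
  have "\<bar>1 + twist row * twist col\<bar> \<ge> 2" if "\<not> (twist row = 0 \<or> twist col * twist row = - 2)"
  proof -
    \<comment> \<open>The determinant is odd, so it suffices to exclude the values 1 and -1. The
      product vanishes only with \<open>twist row\<close>, since \<open>twist col\<close> is
      odd.\<close>
    have "even (twist row * twist col)" "twist row * twist col \<noteq> 0" "twist row * twist col \<noteq> - 2"
      using that assms by (auto simp: mult.commute)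
    then obtain e where "twist row * twist col = 2 * e" "e \<noteq> 0" "e \<noteq> - 1" by (auto elim!: evenE)
    then show ?thesis by arith
  qed
  then show ?thesis
    using free_diagram_unknot free_diagram_not_unknot assms link link_equivalent_iff_teq
    unfolding produces_unknot_def by blast
qed

section \<open>Counting\<close>

lemma twist_conv_count: "twist bs = 2 * int (count_list bs True) - int (length bs)"
  by (induction bs) auto

text \<open>Splitting by the first letter gives Pascal's rule.\<close>

lemma card_count_True: "card {bs. length bs = n \<and> count_list bs True = j} = n choose j"
proof (induction n arbitrary: j)
  case 0
  have "{bs. length bs = 0 \<and> count_list bs True = j} = (if j = 0 then {[]} else {})" by auto
  then show ?case by (cases j) auto
next
  case (Suc n)
  let ?L = "\<lambda>n j. {bs. length bs = n \<and> count_list bs True = j}"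
  have fin: "finite (?L n j)" for j
    by (rule finite_subset[OF _ finite_lists_length_eq[of "UNIV :: bool set" n]]) auto
  have "?L (Suc n) j = Cons False ` ?L n j \<union> (case j of 0 \<Rightarrow> {} | Suc i \<Rightarrow> Cons True ` ?L n i)"
    by (auto simp: length_Suc_conv image_iff split: nat.split if_splits)
  also have "card \<dots> = card (Cons False ` ?L n j) + card (case j of 0 \<Rightarrow> {} | Suc i \<Rightarrow> Cons True ` ?L n i)"
    by (rule card_Un_disjoint) (auto simp: fin split: nat.split)
  also have "\<dots> = Suc n choose j"
    by (cases j) (simp_all add: card_image Suc)
  finally show ?case .
qed

theorem theorem5p12:
  fixes k n :: nat
  assumes "odd k" and "even n" and "0 < n"
  shows "card {(col, row) \<in> assignments k n. produces_unknot (free_diagram col row)}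
    = 2 ^ k * (n choose (n div 2)) + 2 * (k choose ((k - 1) div 2)) * (n choose ((n - 2) div 2))"
proof -
  obtain l where k: "k = 2 * l + 1" using assms(1) by (elim oddE)
  obtain h where n: "n = 2 * h" "h > 0" using assms(2,3) by (auto elim: evenE)
  let ?L = "\<lambda>n j. {bs. length bs = n \<and> count_list bs True = j}"
  \<comment> \<open>\<open>?A\<close> collects the rows of twist 0 with arbitrary columns;
    \<open>?B\<close> has column twist 1 and row twist -2, and \<open>?C\<close> has column twist -1
    and row twist 2.\<close>
  let ?A = "{bs :: bool list. length bs = k} \<times> ?L n h"
  let ?B = "?L k (l + 1) \<times> ?L n (h - 1)" and ?C = "?L k l \<times> ?L n (h + 1)"
  have fin: "finite {bs :: bool list. length bs = m}" for m
    using finite_lists_length_eq[of "UNIV :: bool set" m] by simp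
  \<comment> \<open>Symmetry of the binomial coefficients makes \<open>?B\<close> and
    \<open>?C\<close> equally large, whence the factor 2.\<close>
  have "k - l = l + 1" "l \<le> k" "n - (h - 1) = h + 1" "h - 1 \<le> n" using k n by auto
  then have choose_k: "k choose (l + 1) = k choose l" and choose_n: "n choose (h + 1) = n choose (h - 1)"
    using binomial_symmetric by metis+
  have finL: "finite (?L m j)" for m j by (rule finite_subset[OF _ fin[of m]]) auto
  have fins: "finite ?A" "finite ?B" "finite ?C"
    by (rule finite_cartesian_product[OF fin finL] finite_cartesian_product[OF finL finL])+
  have disj: "?A \<inter> (?B \<union> ?C) = {}" "?B \<inter> ?C = {}" using n by auto
  have "produces_unknot (free_diagram col row) \<longleftrightarrow> (col, row) \<in> ?A \<union> ?B \<union> ?C"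
    if "length col = k" "length row = n" for col row
  proof -
    \<comment> \<open>Centring the counts of \<open>True\<close> turns the condition on the twists
      into \<open>r = 0\<close> or \<open>(2 * c - 1) * r = - 1\<close>, and the latter has just two
      integer solutions.\<close>
    define c r where "c = int (count_list col True) - int l" and "r = int (count_list row True) - int h"
    have tw: "twist col = 2 * c - 1" "twist row = 2 * r"
      using that k n by (auto simp: c_def r_def twist_conv_count)
    have "(2 * c - 1) * r = - 1 \<longleftrightarrow> (c = 1 \<and> r = - 1) \<or> (c = 0 \<and> r = 1)"
    proof
      assume eq: "(2 * c - 1) * r = - 1"
      then have "r dvd 1" by (metis dvd_minus_iff dvd_triv_right)
      then have "r = 1 \<or> r = - 1" by auto
      then show "(c = 1 \<and> r = - 1) \<or> (c = 0 \<and> r = 1)" using eq by auto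
    qed auto
    moreover have "(2 * c - 1) * (2 * r) = 2 * ((2 * c - 1) * r)" by simp
    then have "(2 * c - 1) * (2 * r) = - 2 \<longleftrightarrow> (2 * c - 1) * r = - 1" by arith
    moreover have "row \<noteq> []" using that n by auto
    ultimately have "produces_unknot (free_diagram col row) \<longleftrightarrow>
      r = 0 \<or> (c = 1 \<and> r = - 1) \<or> (c = 0 \<and> r = 1)"
      using produces_unknot_iff[of row col] unfolding tw by simp
    then show ?thesis using that n(2) by (auto simp: c_def r_def)
  qed
  then have "{(col, row) \<in> assignments k n. produces_unknot (free_diagram col row)} = ?A \<union> (?B \<union> ?C)"
    unfolding assignments_def by blast
  then have "card {(col, row) \<in> assignments k n. produces_unknot (free_diagram col row)} = card ?A + (card ?B + card ?C)"
    using card_Un_disjoint[OF fins(1) finite_UnI[OF fins(2,3)] disj(1)]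
      card_Un_disjoint[OF fins(2,3) disj(2)] by (simp only:)
  moreover have "card ?A = 2 ^ k * (n choose h)"
    using card_lists_length_eq[of "UNIV :: bool set" k] by (simp add: card_cartesian_product card_count_True)
  moreover have "card ?B = (k choose l) * (n choose (h - 1))"
    by (simp only: card_cartesian_product card_count_True choose_k)
  moreover have "card ?C = (k choose l) * (n choose (h - 1))"
    by (simp only: card_cartesian_product card_count_True choose_n)
  moreover have "n div 2 = h" "(n - 2) div 2 = h - 1" "(k - 1) div 2 = l" using k n by auto
  ultimately show ?thesis by (simp only: mult_2 distrib_right)
qed

end
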